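(* Let $f:\mathbb{U}\to\mathbb{R}^m$ be a harmonic map (all components harmonic) on the unit disk $\mathbb{U}$. Then (a) $|f|$ and $|f'_t|$ are subharmonic on $\mathbb{U}$; (b) $L(r)$ and $d(r)$ are increasing functions of $r\in[0,1)$.
   Context: $\mathbb{U}$ is the open unit disk in $\mathbb{C}$ and $|\cdot|$ is the Euclidean norm. In polar coordinates $z=re^{it}$, $f'_t$ is the partial derivative of $f$ with respect to the angle $t$ (i.e. $f'_t=x f'_y-y f'_x$). $L(r)=\int_0^{2\pi}|f'_t(re^{it})|\,dt$ is the length of the curve $t\mapsto f(re^{it})$, $t\in[0,2\pi]$, and $d(r)$ is the diameter of $f(\{|z|<r\})$ (with $d(0)=0$). "Increasing" is meant in the non-strict sense. *)

theory Defs
  imports "HOL-Analysis.Analysis"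
begin

definition partial_deriv ::
    "complex \<Rightarrow> (complex \<Rightarrow> 'b::real_normed_vector) \<Rightarrow> complex \<Rightarrow> 'b" where
  "partial_deriv v f z = frechet_derivative f (at z) v"

(* On the type complex, Basis = {1, \<i>}, so the directions v \<in> Basis below are d/dx and d/dy. *)

definition C1_on :: "complex set \<Rightarrow> (complex \<Rightarrow> 'b::real_normed_vector) \<Rightarrow> bool" where
  "C1_on S f \<longleftrightarrow>
     (\<forall>z\<in>S. f differentiable (at z)) \<and> (\<forall>v\<in>Basis. continuous_on S (partial_deriv v f))"

definition C2_on :: "complex set \<Rightarrow> (complex \<Rightarrow> 'b::real_normed_vector) \<Rightarrow> bool" where
  "C2_on S f \<longleftrightarrow> C1_on S f \<and> (\<forall>v\<in>Basis. C1_on S (partial_deriv v f))"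

definition laplacian :: "(complex \<Rightarrow> 'b::real_normed_vector) \<Rightarrow> complex \<Rightarrow> 'b" where
  "laplacian f z = (\<Sum>v\<in>Basis. partial_deriv v (partial_deriv v f) z)"

definition harmonic_on :: "complex set \<Rightarrow> (complex \<Rightarrow> real) \<Rightarrow> bool" where
  "harmonic_on S u \<longleftrightarrow> open S \<and> C2_on S u \<and> (\<forall>z\<in>S. laplacian u z = 0)"

definition harmonic_map_on :: "complex set \<Rightarrow> (complex \<Rightarrow> real ^ 'm) \<Rightarrow> bool" where
  "harmonic_map_on S f \<longleftrightarrow> (\<forall>i. harmonic_on S (\<lambda>z. f z $ i))"

(* Upper semicontinuity together with the sub-mean value inequality on every closed disc in S,
   for functions that do not take the value -\<infinity>.  The mean over a circle dominates the finite
   value u a, so for such functions it is finite; integrability is part of the definition because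
   integral returns 0 on functions that are not integrable. *)
definition subharmonic_on :: "complex set \<Rightarrow> (complex \<Rightarrow> real) \<Rightarrow> bool" where
  "subharmonic_on S u \<longleftrightarrow>
     open S \<and>
     (\<forall>c. openin (top_of_set S) {z \<in> S. u z < c}) \<and>
     (\<forall>a r. 0 < r \<and> cball a r \<subseteq> S \<longrightarrow>
        (\<lambda>t. u (a + of_real r * cis t)) absolutely_integrable_on {0..2 * pi} \<and>
        u a \<le> 1 / (2 * pi) * integral {0..2 * pi} (\<lambda>t. u (a + of_real r * cis t)))"

(* For z = r e^{it}, the points z * cis s = r e^{i(t+s)} trace the circle of radius r, so this is
   the derivative of f (r e^{it}) with respect to t. *)
definition angular_deriv ::
    "(complex \<Rightarrow> 'b::real_normed_vector) \<Rightarrow> complex \<Rightarrow> 'b" where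
  "angular_deriv f z = vector_derivative (\<lambda>s. f (z * cis s)) (at 0)"

lemma angular_deriv_cartesian:
  assumes "f differentiable (at z)"
  shows "angular_deriv f z = Re z *\<^sub>R partial_deriv \<i> f z - Im z *\<^sub>R partial_deriv 1 f z"
proof -
  let ?D = "frechet_derivative f (at z)"
  have D: "(f has_derivative ?D) (at z)"
    using assms frechet_derivative_works by blast
  then interpret D: linear ?D
    using has_derivative_linear by blast
  have "((\<lambda>s. z * cis s) has_vector_derivative z * \<i>) (at 0)"
    unfolding has_vector_derivative_def
    by (rule derivative_eq_intros refl | simp add: scaleR_conv_of_real mult_ac)+
  then have "((f \<circ> (\<lambda>s. z * cis s)) has_vector_derivative ?D (z * \<i>)) (at 0)"
    by (intro vector_derivative_diff_chain_within) (use D in \<open>simp_all add: has_derivative_at_withinI\<close>)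
  then have "angular_deriv f z = ?D (z * \<i>)"
    by (simp add: angular_deriv_def o_def vector_derivative_at)
  also have "z * \<i> = Re z *\<^sub>R \<i> - Im z *\<^sub>R 1"
    by (simp add: complex_eq_iff)
  finally show ?thesis
    by (simp add: partial_deriv_def D.diff D.scale)
qed

lemma angular_deriv_polar:
  "angular_deriv f (of_real r * cis t) = vector_derivative (\<lambda>s. f (of_real r * cis s)) (at t)"
proof -
  have "((\<lambda>s. f (of_real r * cis t * cis s)) has_vector_derivative D) (at 0) \<longleftrightarrow>
        ((\<lambda>s. f (of_real r * cis s)) has_vector_derivative D) (at t)" for D
    by (simp add: has_vector_derivative_def has_derivative_at mult.assoc cis_mult)
  then show ?thesis
    by (simp add: angular_deriv_def vector_derivative_def)
qed

definition image_circle_length ::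
    "(complex \<Rightarrow> 'b::real_normed_vector) \<Rightarrow> real \<Rightarrow> real" where
  "image_circle_length f r = integral {0..2 * pi} (\<lambda>t. norm (angular_deriv f (of_real r * cis t)))"

definition image_disc_diameter ::
    "(complex \<Rightarrow> 'b::real_normed_vector) \<Rightarrow> real \<Rightarrow> real" where
  "image_disc_diameter f r = diameter (f ` ball 0 r)"

end

theory Submission
  imports Defs "HOL-Complex_Analysis.Complex_Analysis"
begin

text \<open>On a convex open set a harmonic function is the real part of a holomorphic function
  (\<open>harmonic_on_imp_Re_holomorphic\<close>). Everything needed about \<open>f\<close> follows from this one property
  of its coordinates, and the angular derivative inherits it
  (\<open>Re_holomorphic_on_angular_deriv\<close>): if \<open>u = Re g\<close>, then \<open>u'\<^sub>t = Re (\<i> z g'(z))\<close>. So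
  \<open>f\<close> and \<open>f'\<^sub>t\<close> can be treated alike.

  Cauchy's formula says that the value of such a map at the centre of a disc is its mean over the
  boundary circle. The norm of a mean is at most the mean of the norms, so the norm of the map is
  subharmonic (\<open>Re_holomorphic_on_norm_subharmonic\<close>).

  For the lengths, write the \<open>L\<^sup>1\<close> norm of \<open>F = f'\<^sub>t\<close> over the circle of radius \<open>r\<close> by duality, as
  the supremum of \<open>\<integral> \<phi>(t) \<bullet> F(r e\<^bsup>it\<^esup>) dt\<close> over continuous \<open>\<phi>\<close> with values in the unit ball. For
  a fixed \<open>\<phi>\<close> the function \<open>z \<mapsto> \<integral> \<phi>(t) \<bullet> F(z e\<^bsup>it\<^esup>) dt\<close> is again the real part of a holomorphic
  function. By the maximum principle its value at \<open>r\<close> is at most its maximum over \<open>|z| = R\<close>, and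
  there it is bounded by the \<open>L\<^sup>1\<close> norm of \<open>F\<close> over the circle of radius \<open>R\<close>, because rotating
  \<open>z\<close> does not change that norm (\<open>Re_holomorphic_pairing_maximum\<close>).

  The diameters increase because the discs do, the image of a smaller closed disc being compact
  and hence bounded.\<close>

section \<open>Harmonic functions as real parts\<close>

lemma partial_deriv_line:
  assumes "u differentiable (at (p + t *\<^sub>R v))"
  shows "((\<lambda>t. u (p + t *\<^sub>R v)) has_vector_derivative partial_deriv v u (p + t *\<^sub>R v)) (at t)"
proof -
  have "(u has_derivative frechet_derivative u (at (p + t *\<^sub>R v))) (at (p + t *\<^sub>R v))"
    using assms frechet_derivative_works by blast
  moreover have "((\<lambda>t. p + t *\<^sub>R v) has_vector_derivative v) (at t)"
    by (auto intro!: derivative_eq_intros)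
  ultimately have "(u \<circ> (\<lambda>t. p + t *\<^sub>R v) has_vector_derivative
      frechet_derivative u (at (p + t *\<^sub>R v)) v) (at t)"
    by (intro vector_derivative_diff_chain_within) (simp_all add: has_derivative_at_withinI)
  then show ?thesis
    by (simp add: partial_deriv_def o_def)
qed

text \<open>The mean value theorem is applied to the difference of \<open>u\<close> along two opposite sides of a
  parallelogram, and then to \<open>\<partial>\<^sub>v u\<close> in the direction \<open>w\<close>. The left-hand side of the conclusion
  does not change when \<open>v\<close> and \<open>w\<close> are exchanged.\<close>

lemma second_difference_mean_value:
  fixes u :: "complex \<Rightarrow> real"
  assumes "0 < h"
    and sub: "\<And>a b. 0 \<le> a \<Longrightarrow> a \<le> h \<Longrightarrow> 0 \<le> b \<Longrightarrow> b \<le> h \<Longrightarrow> p + a *\<^sub>R v + b *\<^sub>R w \<in> S"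
    and u: "\<And>z. z \<in> S \<Longrightarrow> u differentiable (at z)"
    and du: "\<And>z. z \<in> S \<Longrightarrow> partial_deriv v u differentiable (at z)"
  obtains a b where "0 < a" "a < h" "0 < b" "b < h"
    "u (p + h *\<^sub>R v + h *\<^sub>R w) - u (p + h *\<^sub>R v) - u (p + h *\<^sub>R w) + u p =
     h\<^sup>2 * partial_deriv w (partial_deriv v u) (p + a *\<^sub>R v + b *\<^sub>R w)"
proof -
  let ?\<phi> = "\<lambda>a. u (p + h *\<^sub>R w + a *\<^sub>R v) - u (p + a *\<^sub>R v)"
  let ?\<psi> = "\<lambda>a. partial_deriv v u (p + h *\<^sub>R w + a *\<^sub>R v) - partial_deriv v u (p + a *\<^sub>R v)"
  have "(?\<phi> has_real_derivative ?\<psi> a) (at a)" if "0 \<le> a" "a \<le> h" for a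
  proof -
    have "p + h *\<^sub>R w + a *\<^sub>R v \<in> S" "p + a *\<^sub>R v \<in> S"
      using sub[of a h] sub[of a 0] that \<open>0 < h\<close> by (simp_all add: algebra_simps)
    then show ?thesis
      unfolding has_real_derivative_iff_has_vector_derivative
      by (intro has_vector_derivative_diff partial_deriv_line u)
  qed
  then obtain a where a: "0 < a" "a < h" "?\<phi> h - ?\<phi> 0 = (h - 0) * ?\<psi> a"
    using MVT2[OF \<open>0 < h\<close>, of ?\<phi> ?\<psi>] by blast
  let ?\<chi> = "\<lambda>b. partial_deriv v u (p + a *\<^sub>R v + b *\<^sub>R w)"
  have "(?\<chi> has_real_derivative partial_deriv w (partial_deriv v u) (p + a *\<^sub>R v + b *\<^sub>R w)) (at b)"
    if "0 \<le> b" "b \<le> h" for b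
    unfolding has_real_derivative_iff_has_vector_derivative
    using that a sub[of a b] by (intro partial_deriv_line du) auto
  then obtain b where b: "0 < b" "b < h"
    "?\<chi> h - ?\<chi> 0 = (h - 0) * partial_deriv w (partial_deriv v u) (p + a *\<^sub>R v + b *\<^sub>R w)"
    using MVT2[OF \<open>0 < h\<close>, of ?\<chi> "\<lambda>b. partial_deriv w (partial_deriv v u) (p + a *\<^sub>R v + b *\<^sub>R w)"]
    by blast
  show thesis
    by (rule that[OF a(1,2) b(1,2)]) (use a(3) b(3) in \<open>simp add: power2_eq_square algebra_simps\<close>)
qed

text \<open>Clairaut's theorem: the second difference over a small square is symmetric in the two
  directions, and divided by the area it is a value of either mixed derivative near the corner.\<close>

lemma mixed_partials_commute:
  fixes u :: "complex \<Rightarrow> real"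
  assumes "open S" "C2_on S u" "z \<in> S" "v \<in> Basis" "w \<in> Basis"
  shows "partial_deriv w (partial_deriv v u) z = partial_deriv v (partial_deriv w u) z"
proof (rule ccontr)
  let ?A = "partial_deriv w (partial_deriv v u)" and ?B = "partial_deriv v (partial_deriv w u)"
  assume neq: "?A z \<noteq> ?B z"
  define e where "e = dist (?A z) (?B z) / 2"
  have "0 < e"
    using neq by (simp add: e_def)
  have cont: "continuous (at z) ?A" "continuous (at z) ?B"
    using assms by (auto simp: C2_on_def C1_on_def continuous_on_eq_continuous_at)
  obtain d1 where d1: "0 < d1" "\<And>y. dist y z < d1 \<Longrightarrow> dist (?A y) (?A z) < e"
    using cont(1) \<open>0 < e\<close> unfolding continuous_at_eps_delta by (metis dist_norm)
  obtain d2 where d2: "0 < d2" "\<And>y. dist y z < d2 \<Longrightarrow> dist (?B y) (?B z) < e"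
    using cont(2) \<open>0 < e\<close> unfolding continuous_at_eps_delta by (metis dist_norm)
  obtain d3 where d3: "0 < d3" "ball z d3 \<subseteq> S"
    using assms openE by blast
  \<comment> \<open>Points \<open>z + a v + b w\<close> with \<open>0 \<le> a, b \<le> h\<close> have distance at most \<open>2 h\<close> from \<open>z\<close>.\<close>
  define h where "h = min d1 (min d2 d3) / 3"
  have h: "0 < h" "2 * h < d1" "2 * h < d2" "2 * h < d3"
    using d1 d2 d3 by (auto simp: h_def)
  have near: "dist (z + a *\<^sub>R x + b *\<^sub>R y) z \<le> 2 * h"
    if "0 \<le> a" "a \<le> h" "0 \<le> b" "b \<le> h" "x \<in> Basis" "y \<in> Basis" for a b x y
  proof -
    have "norm (a *\<^sub>R x + b *\<^sub>R y) \<le> a + b"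
      using that norm_triangle_ineq[of "a *\<^sub>R x" "b *\<^sub>R y"] by simp
    then show ?thesis
      using that by (simp add: dist_norm add.assoc)
  qed
  have in_S: "z + a *\<^sub>R x + b *\<^sub>R y \<in> S"
    if "0 \<le> a" "a \<le> h" "0 \<le> b" "b \<le> h" "x \<in> Basis" "y \<in> Basis" for a b x y
    using near[OF that] h d3 by (intro subsetD[OF d3(2)]) (simp add: dist_commute)
  have diff: "u differentiable (at y)" "partial_deriv v u differentiable (at y)"
    "partial_deriv w u differentiable (at y)" if "y \<in> S" for y
    using assms that by (auto simp: C2_on_def C1_on_def)
  obtain a b where ab: "0 < a" "a < h" "0 < b" "b < h"
    "u (z + h *\<^sub>R v + h *\<^sub>R w) - u (z + h *\<^sub>R v) - u (z + h *\<^sub>R w) + u z =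
     h\<^sup>2 * ?A (z + a *\<^sub>R v + b *\<^sub>R w)"
    by (rule second_difference_mean_value[of h z v w S u]) (use h in_S diff assms in auto)
  obtain a' b' where ab': "0 < a'" "a' < h" "0 < b'" "b' < h"
    "u (z + h *\<^sub>R w + h *\<^sub>R v) - u (z + h *\<^sub>R w) - u (z + h *\<^sub>R v) + u z =
     h\<^sup>2 * ?B (z + a' *\<^sub>R w + b' *\<^sub>R v)"
    by (rule second_difference_mean_value[of h z w v S u]) (use h in_S diff assms in auto)
  have "h\<^sup>2 * ?A (z + a *\<^sub>R v + b *\<^sub>R w) = h\<^sup>2 * ?B (z + a' *\<^sub>R w + b' *\<^sub>R v)"
    using ab(5) ab'(5) by (simp add: algebra_simps)
  then have "?A (z + a *\<^sub>R v + b *\<^sub>R w) = ?B (z + a' *\<^sub>R w + b' *\<^sub>R v)"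
    using h by simp
  moreover have "dist (?A (z + a *\<^sub>R v + b *\<^sub>R w)) (?A z) < e"
    using near[of a b v w] ab h assms by (intro d1) auto
  moreover have "dist (?B (z + a' *\<^sub>R w + b' *\<^sub>R v)) (?B z) < e"
    using near[of a' b' w v] ab' h assms by (intro d2) auto
  ultimately show False
    by (simp add: e_def dist_real_def) argo
qed

lemma frechet_derivative_partials:
  assumes "u differentiable (at z)"
  shows "(u has_derivative
    (\<lambda>k. Re k *\<^sub>R partial_deriv 1 u z + Im k *\<^sub>R partial_deriv \<i> u z)) (at z)"
proof -
  let ?D = "frechet_derivative u (at z)"
  have D: "(u has_derivative ?D) (at z)"
    using assms frechet_derivative_works by blast
  then interpret D: linear ?D
    using has_derivative_linear by blast
  have "?D k = Re k *\<^sub>R partial_deriv 1 u z + Im k *\<^sub>R partial_deriv \<i> u z" for k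
  proof -
    have "k = Re k *\<^sub>R 1 + Im k *\<^sub>R \<i>"
      by (simp add: complex_eq_iff)
    then have "?D k = ?D (Re k *\<^sub>R 1 + Im k *\<^sub>R \<i>)"
      by (rule arg_cong)
    then show ?thesis
      by (simp add: partial_deriv_def D.add D.scale)
  qed
  then have "?D = (\<lambda>k. Re k *\<^sub>R partial_deriv 1 u z + Im k *\<^sub>R partial_deriv \<i> u z)"
    by (rule ext)
  with D show ?thesis
    by (rule subst[rotated])
qed

text \<open>The Cauchy--Riemann equations of \<open>u\<^sub>x - \<i> u\<^sub>y\<close> are Laplace's equation and the symmetry of the
  mixed derivatives, so this function is holomorphic, and \<open>u\<close> is up to a constant the real part of
  any primitive of it.\<close>

lemma harmonic_on_imp_Re_holomorphic:
  assumes u: "harmonic_on S u" and "convex S"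
  obtains g where "g holomorphic_on S" "\<And>z. z \<in> S \<Longrightarrow> u z = Re (g z)"
proof -
  let ?x = "partial_deriv 1 u" and ?y = "partial_deriv \<i> u"
  define h where "h z = of_real (?x z) - \<i> * of_real (?y z)" for z
  have "open S" and C2: "C2_on S u"
    using u by (auto simp: harmonic_on_def)
  have Bas: "(1 :: complex) \<in> Basis" "\<i> \<in> Basis"
    by (auto simp: Basis_complex_def)
  have diff: "u differentiable (at z)" "?x differentiable (at z)" "?y differentiable (at z)"
    if "z \<in> S" for z
    using C2 that Bas by (auto simp: C2_on_def C1_on_def)
  have "h holomorphic_on S"
    unfolding holomorphic_on_open[OF \<open>open S\<close>]
  proof
    fix z assume z: "z \<in> S"
    let ?d = "of_real (partial_deriv 1 ?x z) - \<i> * of_real (partial_deriv 1 ?y z)"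
    have comm: "partial_deriv \<i> ?x z = partial_deriv 1 ?y z"
      by (rule mixed_partials_commute[OF \<open>open S\<close> C2 z Bas])
    have lap: "partial_deriv \<i> ?y z = - partial_deriv 1 ?x z"
      using u z by (auto simp: harmonic_on_def laplacian_def Basis_complex_def)
    have "(h has_derivative (\<lambda>k.
        of_real (Re k *\<^sub>R partial_deriv 1 ?x z + Im k *\<^sub>R partial_deriv \<i> ?x z) -
        \<i> * of_real (Re k *\<^sub>R partial_deriv 1 ?y z + Im k *\<^sub>R partial_deriv \<i> ?y z))) (at z)"
      unfolding h_def
      by (intro derivative_intros frechet_derivative_partials diff z)
    also have "(\<lambda>k.
        of_real (Re k *\<^sub>R partial_deriv 1 ?x z + Im k *\<^sub>R partial_deriv \<i> ?x z) -
        \<i> * of_real (Re k *\<^sub>R partial_deriv 1 ?y z + Im k *\<^sub>R partial_deriv \<i> ?y z)) = (*) ?d"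
      unfolding comm lap by (auto simp: fun_eq_iff complex_eq_iff algebra_simps)
    finally show "\<exists>d. (h has_field_derivative d) (at z)"
      by (auto simp: has_field_derivative_def)
  qed
  then obtain g where g: "\<And>z. z \<in> S \<Longrightarrow> (g has_field_derivative h z) (at z within S)"
    using holomorphic_convex_primitive'[OF \<open>convex S\<close> \<open>open S\<close>] by blast
  have "((\<lambda>z. u z - Re (g z)) has_derivative (\<lambda>k. 0)) (at z within S)" if z: "z \<in> S" for z
  proof -
    have "((\<lambda>z. Re (g z)) has_derivative (\<lambda>k. Re (h z * k))) (at z within S)"
      using g[OF z] unfolding has_field_derivative_def by (rule has_derivative_Re)
    moreover have "(u has_derivative (\<lambda>k. Re k *\<^sub>R ?x z + Im k *\<^sub>R ?y z)) (at z within S)"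
      by (rule has_derivative_at_withinI[OF frechet_derivative_partials[OF diff(1)[OF z]]])
    ultimately have "((\<lambda>z. u z - Re (g z)) has_derivative
        (\<lambda>k. Re k *\<^sub>R ?x z + Im k *\<^sub>R ?y z - Re (h z * k))) (at z within S)"
      by (rule has_derivative_diff[rotated])
    then show ?thesis
      by (simp add: h_def algebra_simps)
  qed
  then obtain c where c: "\<And>z. z \<in> S \<Longrightarrow> u z - Re (g z) = c"
    using has_derivative_zero_constant[OF \<open>convex S\<close>, of "\<lambda>z. u z - Re (g z)"] by blast
  show thesis
  proof
    show "(\<lambda>z. g z + of_real c) holomorphic_on S"
      using g by (intro holomorphic_intros) (auto simp: holomorphic_on_def field_differentiable_def)
    show "u z = Re (g z + of_real c)" if "z \<in> S" for z
      using c[OF that] by simp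
  qed
qed

text \<open>This is stated for a Euclidean space rather than for \<open>real ^ 'm\<close>, so that it speaks of inner
  products with basis vectors; the arguments below then use only the inner product.\<close>

definition Re_holomorphic_on :: "complex set \<Rightarrow> (complex \<Rightarrow> 'a::euclidean_space) \<Rightarrow> bool" where
  "Re_holomorphic_on S F \<longleftrightarrow>
     (\<forall>b\<in>Basis. \<exists>g. g holomorphic_on S \<and> (\<forall>z\<in>S. F z \<bullet> b = Re (g z)))"

lemma Re_holomorphic_onE:
  assumes "Re_holomorphic_on S F"
  obtains g where "\<And>b. b \<in> Basis \<Longrightarrow> g b holomorphic_on S"
    "\<And>b z. b \<in> Basis \<Longrightarrow> z \<in> S \<Longrightarrow> F z \<bullet> b = Re (g b z)"
proof -
  obtain g where "\<forall>b\<in>Basis. g b holomorphic_on S \<and> (\<forall>z\<in>S. F z \<bullet> b = Re (g b z))"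
    using bchoice[OF assms[unfolded Re_holomorphic_on_def]] by (rule exE)
  then show thesis
    by (intro that[of g]) simp_all
qed

lemma harmonic_map_on_imp_Re_holomorphic_on:
  fixes f :: "complex \<Rightarrow> real ^ 'm"
  assumes "harmonic_map_on S f" "convex S"
  shows "Re_holomorphic_on S f"
  unfolding Re_holomorphic_on_def
proof
  fix b :: "real ^ 'm"
  assume "b \<in> Basis"
  then obtain i where b: "b = axis i 1"
    by (auto simp: Basis_vec_def)
  have "harmonic_on S (\<lambda>z. f z $ i)"
    using assms by (simp add: harmonic_map_on_def)
  then obtain g where "g holomorphic_on S" "\<And>z. z \<in> S \<Longrightarrow> f z $ i = Re (g z)"
    using harmonic_on_imp_Re_holomorphic[OF _ assms(2)] by blast
  then show "\<exists>g. g holomorphic_on S \<and> (\<forall>z\<in>S. f z \<bullet> b = Re (g z))"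
    by (auto simp: b inner_axis)
qed

lemma Re_holomorphic_on_imp_continuous_on:
  assumes "Re_holomorphic_on S F"
  shows "continuous_on S F"
proof (rule continuous_on_componentwise[THEN iffD2], rule)
  fix b :: 'a
  assume "b \<in> Basis"
  then obtain g where "g holomorphic_on S" "\<And>z. z \<in> S \<Longrightarrow> F z \<bullet> b = Re (g z)"
    using assms by (auto simp: Re_holomorphic_on_def)
  then show "continuous_on S (\<lambda>z. F z \<bullet> b)"
    by (simp add: holomorphic_on_imp_continuous_on continuous_on_Re cong: continuous_on_cong)
qed

text \<open>Differentiating \<open>g (z e\<^bsup>is\<^esup>)\<close> at \<open>s = 0\<close> gives \<open>\<i> z g'(z)\<close>, which is holomorphic in \<open>z\<close>.\<close>

lemma Re_holomorphic_on_angular_deriv: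
  assumes F: "Re_holomorphic_on S F" and "open S"
  shows "Re_holomorphic_on S (angular_deriv F)"
proof -
  obtain g where hol: "\<And>b. b \<in> Basis \<Longrightarrow> g b holomorphic_on S"
    and g: "\<And>b z. b \<in> Basis \<Longrightarrow> z \<in> S \<Longrightarrow> F z \<bullet> b = Re (g b z)"
    by (rule Re_holomorphic_onE[OF F]) blast
  have ang: "angular_deriv F z \<bullet> b = Re (\<i> * z * deriv (g b) z)" if z: "z \<in> S" and b: "b \<in> Basis" for z b
  proof -
    let ?D = "\<Sum>b\<in>Basis. Re (\<i> * z * deriv (g b) z) *\<^sub>R b"
    have "((\<lambda>s. F (z * cis s)) has_vector_derivative ?D) (at 0)"
      unfolding has_vector_derivative_def
    proof (rule has_derivative_componentwise_within[THEN iffD2], rule)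
      fix b :: 'a
      assume b: "b \<in> Basis"
      have opn: "open ((\<lambda>s. z * cis s) -` S)"
        by (intro open_vimage \<open>open S\<close> continuous_intros)
      have "(g b has_field_derivative deriv (g b) z) (at (z * cis 0))"
        using holomorphic_derivI[OF hol[OF b] \<open>open S\<close> z] by simp
      moreover have "((\<lambda>s. z * cis s) has_vector_derivative z * \<i>) (at 0)"
        unfolding has_vector_derivative_def
        by (rule derivative_eq_intros refl | simp add: scaleR_conv_of_real mult_ac)+
      ultimately have "((g b \<circ> (\<lambda>s. z * cis s)) has_vector_derivative z * \<i> * deriv (g b) z) (at 0)"
        by (rule field_vector_diff_chain_at[rotated])
      then have "((\<lambda>s. Re (g b (z * cis s))) has_derivative (\<lambda>h. Re (h *\<^sub>R (z * \<i> * deriv (g b) z)))) (at 0)"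
        unfolding has_vector_derivative_def o_def by (rule has_derivative_Re)
      moreover have "(h *\<^sub>R ?D) \<bullet> b = Re (h *\<^sub>R (z * \<i> * deriv (g b) z))" for h
        using b by (simp add: mult_ac)
      ultimately have "((\<lambda>s. Re (g b (z * cis s))) has_derivative (\<lambda>h. (h *\<^sub>R ?D) \<bullet> b)) (at 0)"
        by (simp only:)
      then show "((\<lambda>s. F (z * cis s) \<bullet> b) has_derivative (\<lambda>h. (h *\<^sub>R ?D) \<bullet> b)) (at 0)"
        by (rule has_derivative_transform_within_open[OF _ opn]) (use z g b in auto)
    qed
    then have "angular_deriv F z = ?D"
      unfolding angular_deriv_def by (rule vector_derivative_at)
    then show ?thesis
      using b by simp
  qed
  show ?thesis
    unfolding Re_holomorphic_on_def
  proof
    fix b :: 'a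
    assume b: "b \<in> Basis"
    have "(\<lambda>z. \<i> * z * deriv (g b) z) holomorphic_on S"
      by (intro holomorphic_intros hol b \<open>open S\<close>)
    with ang b show "\<exists>g. g holomorphic_on S \<and> (\<forall>z\<in>S. angular_deriv F z \<bullet> b = Re (g z))"
      by blast
  qed
qed

section \<open>Mean values and subharmonicity\<close>

lemma holomorphic_mean_value:
  fixes g :: "complex \<Rightarrow> complex"
  assumes "g holomorphic_on S" "cball a r \<subseteq> S" "0 < r"
  shows "((\<lambda>t. g (a + of_real r * cis t)) has_integral of_real (2 * pi) * g a) {0..2 * pi}"
proof -
  have "((\<lambda>z. g z / (z - a)) has_contour_integral 2 * of_real pi * \<i> * g a) (circlepath a r)"
  proof (rule Cauchy_integral_circlepath)
    show "continuous_on (cball a r) g"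
      using assms holomorphic_on_imp_continuous_on continuous_on_subset by blast
    show "g holomorphic_on ball a r"
      using assms ball_subset_cball holomorphic_on_subset by blast
  qed (use assms in auto)
  then have "((\<lambda>t. g (a + of_real r * cis t) / (a + of_real r * cis t - a) * of_real r * \<i> * cis t)
      has_integral 2 * of_real pi * \<i> * g a) {0..2 * pi}"
    unfolding circlepath_def by (subst (asm) has_contour_integral_part_circlepath_iff) auto
  then have "((\<lambda>t. \<i> * g (a + of_real r * cis t)) has_integral 2 * of_real pi * \<i> * g a) {0..2 * pi}"
    by (rule has_integral_eq[rotated]) (use assms in simp)
  from has_integral_mult_right[OF this, of "- \<i>"] show ?thesis
    by (simp add: mult_ac)
qed

lemma Re_holomorphic_on_mean_value:
  assumes F: "Re_holomorphic_on S F" and "cball a r \<subseteq> S" "0 < r"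
  shows "((\<lambda>t. F (a + of_real r * cis t)) has_integral (2 * pi) *\<^sub>R F a) {0..2 * pi}"
proof (rule has_integral_componentwise_iff[THEN iffD2], rule)
  fix b :: 'a
  assume "b \<in> Basis"
  then obtain g where g: "g holomorphic_on S" "\<And>z. z \<in> S \<Longrightarrow> F z \<bullet> b = Re (g z)"
    using F by (auto simp: Re_holomorphic_on_def)
  have S: "a + of_real r * cis t \<in> S" "a \<in> S" for t
    using assms by (auto intro!: subsetD[OF assms(2)] simp: dist_norm norm_mult)
  show "((\<lambda>t. F (a + of_real r * cis t) \<bullet> b) has_integral (2 * pi) *\<^sub>R F a \<bullet> b) {0..2 * pi}"
    using has_integral_linear[OF holomorphic_mean_value[OF g(1) assms(2,3)] bounded_linear_Re] S g(2)
    by (simp add: o_def)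
qed

lemma Re_holomorphic_on_norm_subharmonic:
  assumes F: "Re_holomorphic_on S F" and "open S"
  shows "subharmonic_on S (\<lambda>z. norm (F z))"
  unfolding subharmonic_on_def
proof (intro conjI allI impI)
  have cont: "continuous_on S (\<lambda>z. norm (F z))"
    by (intro continuous_on_norm Re_holomorphic_on_imp_continuous_on F)
  show "openin (top_of_set S) {z \<in> S. norm (F z) < c}" for c
    using continuous_openin_preimage_gen[OF cont, of "{..<c}"]
    by (simp add: vimage_def Int_def conj_commute)
  fix a :: complex and r :: real
  assume ar: "0 < r \<and> cball a r \<subseteq> S"
  let ?N = "\<lambda>t. norm (F (a + of_real r * cis t))"
  have "a + of_real r * cis t \<in> S" for t
    using ar by (auto intro!: subsetD[of "cball a r" S] simp: dist_norm norm_mult)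
  then have "continuous_on {0..2 * pi} ?N"
    by (intro continuous_on_compose2[OF cont] continuous_intros) auto
  then show N: "?N absolutely_integrable_on {0..2 * pi}"
    by (intro absolutely_integrable_continuous_real)
  have mean: "((\<lambda>t. F (a + of_real r * cis t)) has_integral (2 * pi) *\<^sub>R F a) {0..2 * pi}"
    using ar F by (intro Re_holomorphic_on_mean_value) auto
  have "norm ((2 * pi) *\<^sub>R F a) \<le> integral {0..2 * pi} ?N"
    unfolding integral_unique[OF mean, symmetric] using mean N
    by (intro integral_norm_bound_integral)
      (auto simp: has_integral_integrable absolutely_integrable_on_def)
  then show "norm (F a) \<le> 1 / (2 * pi) * integral {0..2 * pi} ?N"
    by (simp add: field_simps)
qed (fact \<open>open S\<close>)

section \<open>Monotonicity of integrals over circles\<close>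

lemma integral_circle_rotate:
  fixes N :: "complex \<Rightarrow> real"
  assumes "continuous_on (sphere 0 (norm z)) N"
  shows "integral {0..2 * pi} (\<lambda>t. N (z * cis t)) =
         integral {0..2 * pi} (\<lambda>t. N (of_real (norm z) * cis t))"
proof -
  define s where "s = Arg2pi z"
  let ?P = "\<lambda>t. N (of_real (norm z) * cis t)"
  have s: "0 \<le> s" "s \<le> 2 * pi"
    using Arg2pi_ge_0[of z] Arg2pi_lt_2pi[of z] by (auto simp: s_def)
  have z: "z = of_real (norm z) * cis s"
    using Arg2pi_eq[of z] by (simp add: s_def cis_conv_exp)
  have int: "?P integrable_on {a..b}" for a b
    by (intro integrable_continuous_real continuous_on_compose2[OF assms])
      (auto intro!: continuous_intros simp: norm_mult)
  have "integral {0..2 * pi} (\<lambda>t. N (z * cis t)) = integral {0..2 * pi} (\<lambda>t. ?P (t + s))"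
    by (subst z) (simp add: mult.assoc cis_mult add.commute)
  also have "\<dots> = integral {s..2 * pi + s} ?P"
    using integral_shift_real_ivl[of s s "2 * pi + s" ?P] by simp
  also have "\<dots> = integral {s..2 * pi} ?P + integral {2 * pi..2 * pi + s} ?P"
    using s int by (intro Henstock_Kurzweil_Integration.integral_combine[symmetric]) auto
  also have "integral {2 * pi..2 * pi + s} ?P = integral {0..s} (\<lambda>t. ?P (t + 2 * pi))"
    using integral_shift_real_ivl[of "2 * pi" "2 * pi" "2 * pi + s" ?P] by simp
  also have "\<dots> = integral {0..s} ?P"
    by (simp add: cis_mult[symmetric])
  also have "integral {s..2 * pi} ?P + integral {0..s} ?P = integral {0..2 * pi} ?P"
    using s int Henstock_Kurzweil_Integration.integral_combine[of 0 s "2 * pi" ?P] by simp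
  finally show ?thesis .
qed

text \<open>The pairing \<open>H\<close> of the proof rotates the argument of \<open>F\<close> against a fixed density \<open>\<phi>\<close>. It is
  therefore holomorphic in the point that is rotated, whatever \<open>\<phi>\<close> is, and the maximum principle
  compares circles of different radii.\<close>

lemma Re_holomorphic_pairing_maximum:
  fixes F :: "complex \<Rightarrow> 'a::euclidean_space"
  assumes F: "Re_holomorphic_on (ball 0 \<rho>) F" and "0 \<le> r" "r \<le> R" "R < \<rho>"
    and \<phi>: "continuous_on {0..2 * pi} \<phi>" "\<And>t. norm (\<phi> t) \<le> 1"
  shows "integral {0..2 * pi} (\<lambda>t. \<phi> t \<bullet> F (of_real r * cis t)) \<le>
         integral {0..2 * pi} (\<lambda>t. norm (F (of_real R * cis t)))"
proof -
  let ?B = "ball (0::complex) \<rho>"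
  obtain g where hol: "\<And>b. b \<in> Basis \<Longrightarrow> g b holomorphic_on ?B"
    and g: "\<And>b z. b \<in> Basis \<Longrightarrow> z \<in> ?B \<Longrightarrow> F z \<bullet> b = Re (g b z)"
    by (rule Re_holomorphic_onE[OF F]) blast
  define f where "f z t = (\<Sum>b\<in>Basis. of_real (\<phi> t \<bullet> b) * g b (z * cis t))" for z t
  define f' where
    "f' z t = (\<Sum>b\<in>Basis. of_real (\<phi> t \<bullet> b) * (deriv (g b) (z * cis t) * cis t))" for z t
  define H where "H z = integral {0..2 * pi} (f z)" for z
  have rot: "z * cis t \<in> ?B" if "z \<in> ?B" for z t
    using that by (simp add: norm_mult)
  have cont_g: "continuous_on ?B (g b)" "continuous_on ?B (deriv (g b))" if "b \<in> Basis" for b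
    using hol[OF that] by (auto intro!: holomorphic_on_imp_continuous_on holomorphic_deriv)
  have int_f: "f z integrable_on {0..2 * pi}" if "z \<in> ?B" for z
    unfolding f_def using that
    by (intro integrable_continuous_real continuous_intros \<phi>
        continuous_on_compose2[OF cont_g(1)]) (auto simp: norm_mult)
  have "(\<lambda>z. integral (cbox 0 (2 * pi)) (f z)) holomorphic_on ?B"
  proof (rule leibniz_rule_holomorphic[where fx = f'])
    show "((\<lambda>z. f z t) has_field_derivative f' z t) (at z within ?B)" if "z \<in> ?B" for z t
    proof -
      have "((\<lambda>z. g b (z * cis t)) has_field_derivative deriv (g b) (z * cis t) * cis t) (at z)"
        if b: "b \<in> Basis" for b
      proof (rule DERIV_chain2[where f = "g b"])
        show "(g b has_field_derivative deriv (g b) (z * cis t)) (at (z * cis t))"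
          using holomorphic_derivI[OF hol[OF b] _ rot[OF \<open>z \<in> ?B\<close>]] by simp
      qed (auto intro!: derivative_eq_intros)
      then show ?thesis
        unfolding f_def f'_def by (intro DERIV_sum DERIV_cmult has_field_derivative_at_within[where s = ?B]) auto
    qed
    have "continuous_on (?B \<times> cbox 0 (2 * pi)) (\<lambda>p. f' (fst p) (snd p))"
      unfolding f'_def
      by (intro continuous_intros continuous_on_compose2[OF cont_g(2)] continuous_on_compose2[OF \<phi>(1)])
        (auto simp: norm_mult)
    then show "continuous_on (?B \<times> cbox 0 (2 * pi)) (\<lambda>(z, t). f' z t)"
      by (simp add: case_prod_unfold)
  qed (use int_f in auto)
  then have holH: "H holomorphic_on ?B"
    by (simp add: H_def[abs_def])
  have Re_f: "Re (f z t) = \<phi> t \<bullet> F (z * cis t)" if "z \<in> ?B" for z t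
  proof -
    have "\<phi> t \<bullet> F (z * cis t) = (\<Sum>b\<in>Basis. (\<phi> t \<bullet> b) * (F (z * cis t) \<bullet> b))"
      by (rule euclidean_inner)
    also have "\<dots> = Re (f z t)"
      using g rot[OF that] by (simp add: f_def)
    finally show ?thesis ..
  qed
  have Re_H: "((\<lambda>t. \<phi> t \<bullet> F (z * cis t)) has_integral Re (H z)) {0..2 * pi}" if "z \<in> ?B" for z
    using has_integral_linear[OF integrable_integral[OF int_f[OF that]] bounded_linear_Re]
    by (simp add: o_def Re_f[OF that] H_def)
  have contF: "continuous_on ?B F"
    by (rule Re_holomorphic_on_imp_continuous_on[OF F])
  have bound: "Re (H z) \<le> integral {0..2 * pi} (\<lambda>t. norm (F (of_real R * cis t)))"
    if "norm z = R" for z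
  proof -
    have z: "z \<in> ?B"
      using that \<open>R < \<rho>\<close> by simp
    have "continuous_on {0..2 * pi} (\<lambda>t. norm (F (z * cis t)))"
      by (intro continuous_intros continuous_on_compose2[OF contF]) (use z in \<open>auto simp: norm_mult\<close>)
    then have "((\<lambda>t. norm (F (z * cis t))) has_integral
        integral {0..2 * pi} (\<lambda>t. norm (F (z * cis t)))) {0..2 * pi}"
      by (intro integrable_integral integrable_continuous_real)
    then have "Re (H z) \<le> integral {0..2 * pi} (\<lambda>t. norm (F (z * cis t)))"
    proof (rule has_integral_le[OF Re_H[OF z]])
      show "\<phi> t \<bullet> F (z * cis t) \<le> norm (F (z * cis t))" for t
        using norm_cauchy_schwarz[of "\<phi> t" "F (z * cis t)"] \<phi>(2)[of t]
          mult_right_mono[of "norm (\<phi> t)" 1 "norm (F (z * cis t))"] by simp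
    qed
    also have "\<dots> = integral {0..2 * pi} (\<lambda>t. norm (F (of_real (norm z) * cis t)))"
      by (rule integral_circle_rotate, intro continuous_on_norm continuous_on_subset[OF contF])
        (use z in auto)
    finally show ?thesis
      using that by simp
  qed
  have "Re (H (of_real r)) \<le> integral {0..2 * pi} (\<lambda>t. norm (F (of_real R * cis t)))"
  proof (rule maximum_real_frontier[where f = H and S = "cball 0 R"])
    show "H holomorphic_on interior (cball 0 R)"
      using holH by (rule holomorphic_on_subset) (use \<open>R < \<rho>\<close> in auto)
    show "continuous_on (closure (cball 0 R)) H"
      using holomorphic_on_imp_continuous_on[OF holH]
      by (rule continuous_on_subset) (use \<open>R < \<rho>\<close> in auto)
  qed (use bound assms in auto)
  then show ?thesis
    using integral_unique[OF Re_H[of "of_real r"]] assms by simp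
qed

text \<open>The optimal density \<open>F / |F|\<close> is discontinuous at the zeros of \<open>F\<close>. Dividing by
  \<open>sqrt (|F|\<^sup>2 + e\<^sup>2)\<close> instead makes it continuous at the cost of at most \<open>e\<close> in the integrand.\<close>

lemma Re_holomorphic_circle_integral_mono:
  fixes F :: "complex \<Rightarrow> 'a::euclidean_space"
  assumes F: "Re_holomorphic_on (ball 0 \<rho>) F" and r: "0 \<le> r" "r \<le> R" "R < \<rho>"
  shows "integral {0..2 * pi} (\<lambda>t. norm (F (of_real r * cis t))) \<le>
         integral {0..2 * pi} (\<lambda>t. norm (F (of_real R * cis t)))" (is "?L \<le> ?M")
proof -
  have cont: "continuous_on {0..2 * pi} (\<lambda>t. F (of_real r * cis t))"
    by (intro continuous_on_compose2[OF Re_holomorphic_on_imp_continuous_on[OF F]])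
      (use r in \<open>auto intro!: continuous_intros simp: norm_mult\<close>)
  have approx: "?L - 2 * pi * e \<le> ?M" if "0 < e" for e
  proof -
    define D where "D t = sqrt ((norm (F (of_real r * cis t)))\<^sup>2 + e\<^sup>2)" for t
    define \<phi> where "\<phi> t = F (of_real r * cis t) /\<^sub>R D t" for t
    have D: "0 < D t" "norm (F (of_real r * cis t)) \<le> D t"
      "D t \<le> norm (F (of_real r * cis t)) + e" for t
    proof -
      show "0 < D t"
        using that unfolding D_def by (intro real_sqrt_gt_zero add_nonneg_pos) auto
      show "norm (F (of_real r * cis t)) \<le> D t"
        unfolding D_def by (intro real_le_rsqrt) simp
      show "D t \<le> norm (F (of_real r * cis t)) + e"
        unfolding D_def using that sqrt_sum_squares_le_sum by simp
    qed
    have cont_\<phi>: "continuous_on {0..2 * pi} \<phi>"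
      unfolding \<phi>_def using D(1) less_imp_neq[OF D(1)]
      by (intro continuous_intros cont) (auto simp: D_def intro!: continuous_intros cont)
    have "norm (\<phi> t) \<le> 1" for t
      using D[of t] by (simp add: \<phi>_def divide_simps)
    have ge: "norm (F (of_real r * cis t)) - e \<le> \<phi> t \<bullet> F (of_real r * cis t)" for t
    proof -
      let ?n = "norm (F (of_real r * cis t))"
      have "(?n - e) * D t \<le> ?n\<^sup>2"
      proof (cases "?n \<le> e")
        case True
        then have "(?n - e) * D t \<le> 0"
          using D(1)[of t] by (intro mult_nonpos_nonneg) auto
        then show ?thesis
          by (meson order_trans zero_le_power2)
      next
        case False
        then have "(?n - e) * D t \<le> (?n - e) * (?n + e)"
          using D(3)[of t] by (intro mult_left_mono) auto
        also have "\<dots> \<le> ?n\<^sup>2"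
          by (simp add: power2_eq_square algebra_simps)
        finally show ?thesis .
      qed
      then show ?thesis
        using D(1)[of t] by (simp add: \<phi>_def power2_norm_eq_inner field_simps)
    qed
    have "?L - 2 * pi * e = integral {0..2 * pi} (\<lambda>t. norm (F (of_real r * cis t)) - e)"
      by (subst Henstock_Kurzweil_Integration.integral_diff)
        (auto intro!: integrable_continuous_real continuous_intros cont)
    also have "\<dots> \<le> integral {0..2 * pi} (\<lambda>t. \<phi> t \<bullet> F (of_real r * cis t))"
      by (intro integral_le integrable_continuous_real continuous_intros cont cont_\<phi> ge)
    also have "\<dots> \<le> ?M"
      by (rule Re_holomorphic_pairing_maximum[OF F r cont_\<phi>]) fact
    finally show ?thesis .
  qed
  show ?thesis
  proof (rule field_le_epsilon)
    fix e :: real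
    assume "0 < e"
    then show "?L \<le> ?M + e"
      using approx[of "e / (2 * pi)"] by (simp add: field_simps)
  qed
qed

theorem theorem14:
  fixes f :: "complex \<Rightarrow> real ^ 'm"
  assumes "harmonic_map_on (ball 0 1) f"
  shows "subharmonic_on (ball 0 1) (\<lambda>z. norm (f z))
       \<and> subharmonic_on (ball 0 1) (\<lambda>z. norm (angular_deriv f z))
       \<and> mono_on {0..<1} (image_circle_length f)
       \<and> mono_on {0..<1} (image_disc_diameter f)"
proof (intro conjI)
  have f: "Re_holomorphic_on (ball 0 1) f"
    by (rule harmonic_map_on_imp_Re_holomorphic_on[OF assms convex_ball])
  then have f_t: "Re_holomorphic_on (ball 0 1) (angular_deriv f)"
    by (rule Re_holomorphic_on_angular_deriv) simp
  show "subharmonic_on (ball 0 1) (\<lambda>z. norm (f z))"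
    by (rule Re_holomorphic_on_norm_subharmonic[OF f open_ball])
  show "subharmonic_on (ball 0 1) (\<lambda>z. norm (angular_deriv f z))"
    by (rule Re_holomorphic_on_norm_subharmonic[OF f_t open_ball])
  show "mono_on {0..<1} (image_circle_length f)"
    unfolding image_circle_length_def
    by (rule mono_onI) (auto intro: Re_holomorphic_circle_integral_mono[OF f_t])
  show "mono_on {0..<1} (image_disc_diameter f)"
  proof (rule mono_onI)
    fix r s :: real
    assume rs: "r \<in> {0..<1}" "s \<in> {0..<1}" "r \<le> s"
    have "compact (f ` cball 0 s)"
      using rs by (intro compact_continuous_image compact_cball
          continuous_on_subset[OF Re_holomorphic_on_imp_continuous_on[OF f]]) auto
    then have "bounded (f ` ball 0 s)"
      by (rule bounded_subset[OF compact_imp_bounded]) auto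
    then show "image_disc_diameter f r \<le> image_disc_diameter f s"
      unfolding image_disc_diameter_def using rs by (intro diameter_subset) auto
  qed
qed

end
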